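(* Let $\Lambda$ be a row-finite $k$-graph with no sources, let $v\in\Lambda^0$, and let $\Lambda_I$ be the in-split of $\Lambda$ at $v$ with respect to a partition $v\Lambda^{\mathbf 1}=\mathcal E_1\cup\mathcal E_2$ into two nonempty sets satisfying the pairing condition. The map $\phi_I:T_\Lambda\longrightarrow T_{\Lambda_I}$ defined on generators by $$\phi_I(w(\mathbf n))=\begin{cases} w(\mathbf n) & \text{if } w\neq v,\\ v^1(\mathbf n)+v^2(\mathbf n) & \text{if } w=v,\end{cases}$$ for all $w\in\Lambda^0$ and $\mathbf n\in\mathbb Z^k$, is a $\mathbb Z^k$-monoid isomorphism.
   Context: $\mathbb N=\{0,1,2,\dots\}$, and $\mathbf e_1,\dots,\mathbf e_k$ is the standard basis of $\mathbb N^k$. A $k$-graph is a countable small category $\Lambda$ with a functor $d:\Lambda\to\mathbb N^k$ (degree) such that whenever $d(\lambda)=\mathbf n+\mathbf m$ there are unique $\alpha,\beta$ with $d(\alpha)=\mathbf n$, $d(\beta)=\mathbf m$, $\lambda=\alpha\beta$. Range and source are $r,s$; $\lambda\mu$ is defined when $s(\lambda)=r(\mu)$. Put $\Lambda^{\mathbf n}=d^{-1}(\mathbf n)$ ($\Lambda^0$ is identified with the objects, called vertices), $u\Lambda^{\mathbf n}=r^{-1}(u)\cap\Lambda^{\mathbf n}$, $\Lambda^{\mathbf n}v=\Lambda^{\mathbf n}\cap s^{-1}(v)$, $\Lambda^{\mathbf 1}=\bigcup_{i=1}^k\Lambda^{\mathbf e_i}$ (edges), $v\Lambda^{\mathbf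 1}=\bigcup_i v\Lambda^{\mathbf e_i}$, $\Lambda^{\mathbf 1}v=\bigcup_i\Lambda^{\mathbf e_i}v$. $\Lambda$ is row-finite without sources if $0<|v\Lambda^{\mathbf n}|<\infty$ for all $v\in\Lambda^0,\mathbf n\in\mathbb N^k$. Talented monoid: $T_\Lambda$ is the commutative monoid generated by symbols $v(\mathbf n)$, $v\in\Lambda^0,\mathbf n\in\mathbb Z^k$, subject to $v(\mathbf n)=\sum_{\alpha\in v\Lambda^{\mathbf e_i}}s(\alpha)(\mathbf n+\mathbf e_i)$ for all $v$, $\mathbf n$ and $i=1,\dots,k$. $\mathbb Z^k$ acts on it by ${}^{\mathbf m}v(\mathbf n)=v(\mathbf n+\mathbf m)$. A $\mathbb Z^k$-monoid isomorphism is a monoid isomorphism commuting with the $\mathbb Z^k$-actions. In-split: the pairing condition on the partition says that if $\lambda,\mu\in v\Lambda^{\mathbf 1}$ and $\lambda\alpha=\mu\beta$ for some $\alpha,\beta\in\Lambda^{\mathbf 1}$, then $\lambda,\mu$ lie in the same set $\mathcal E_j$. The $k$-graph $\Lambda_I$ has vertices $\Lambda_I^0=(\Lambda^0\setminus\{v\})\cup\{v^1,v^2\}$ and edges $\Lambda_I^{\mathbf 1}=(\Lambda^{\mathbf 1}\setminus\Lambda^{\mathbf 1}v)\cup\{f^1,f^2: f\in\Lambda^{\mathbf 1}v\}$. Parents: $par(v^i)=v$, $par(f^i)=f$, $par(x)=x$ otherwise. An edge $\alpha$ of $\Lambda_I$ has degree $d_I(\alpha)=d(par(\alpha))$; range $r_I(\alpha)=r(par(\alpha))$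 if $r(par(\alpha))\ne v$, and $r_I(\alpha)=v^j$ if $par(\alpha)\in\mathcal E_j$; source $s_I(\alpha)=s(\alpha)$ if $\alpha\in\Lambda^{\mathbf 1}\setminus\Lambda^{\mathbf 1}v$ and $s_I(f^i)=v^i$. Extend $par$ multiplicatively to edge paths. $\Lambda_I$ is the path category of this coloured graph modulo identifying two edge paths with the same range, the same source and the same parent in $\Lambda$ (i.e. factorization in $\Lambda_I$ is determined by factorization of parents in $\Lambda$). This is a row-finite $k$-graph without sources. *)

theory Defs
  imports
    "HOL-Analysis.Finite_Cartesian_Product"
    "HOL-Library.Multiset"
    "HOL-Library.Countable_Set"
    "HOL-Algebra.Group"
begin

section \<open>Higher-rank graphs\<close>

text \<open>
  The rank \<open>k\<close> is the cardinality of the finite index type \<open>'k\<close>, and the standard basis vector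
  indexed by \<open>i\<close> is \<^term>\<open>axis i 1\<close>. Composition is written as in the \<open>k\<close>-graph literature:
  \<open>cmp \<Lambda> \<kappa> \<mu>\<close> is \<open>\<kappa>\<mu>\<close>, which is meaningful when \<open>src \<Lambda> \<kappa> = rng \<Lambda> \<mu>\<close>.
\<close>

record ('v, 'm, 'k::finite) kgraph =
  Vert :: "'v set"
  Mor :: "'m set"
  rng :: "'m \<Rightarrow> 'v"
  src :: "'m \<Rightarrow> 'v"
  idm :: "'v \<Rightarrow> 'm"
  cmp :: "'m \<Rightarrow> 'm \<Rightarrow> 'm"
  degr :: "'m \<Rightarrow> nat ^ 'k"

locale small_category =
  fixes \<Lambda> :: "('v, 'm, 'k::finite) kgraph"
  assumes rng_closed: "\<kappa> \<in> Mor \<Lambda> \<Longrightarrow> rng \<Lambda> \<kappa> \<in> Vert \<Lambda>"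
    and src_closed: "\<kappa> \<in> Mor \<Lambda> \<Longrightarrow> src \<Lambda> \<kappa> \<in> Vert \<Lambda>"
    and idm_closed: "w \<in> Vert \<Lambda> \<Longrightarrow> idm \<Lambda> w \<in> Mor \<Lambda>"
    and rng_idm: "w \<in> Vert \<Lambda> \<Longrightarrow> rng \<Lambda> (idm \<Lambda> w) = w"
    and src_idm: "w \<in> Vert \<Lambda> \<Longrightarrow> src \<Lambda> (idm \<Lambda> w) = w"
    and cmp_closed: "\<lbrakk>\<kappa> \<in> Mor \<Lambda>; \<mu> \<in> Mor \<Lambda>; src \<Lambda> \<kappa> = rng \<Lambda> \<mu>\<rbrakk> \<Longrightarrow> cmp \<Lambda> \<kappa> \<mu> \<in> Mor \<Lambda>"
    and rng_cmp: "\<lbrakk>\<kappa> \<in> Mor \<Lambda>; \<mu> \<in> Mor \<Lambda>; src \<Lambda> \<kappa> = rng \<Lambda> \<mu>\<rbrakk> \<Longrightarrow> rng \<Lambda> (cmp \<Lambda> \<kappa> \<mu>) = rng \<Lambda> \<kappa>"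
    and src_cmp: "\<lbrakk>\<kappa> \<in> Mor \<Lambda>; \<mu> \<in> Mor \<Lambda>; src \<Lambda> \<kappa> = rng \<Lambda> \<mu>\<rbrakk> \<Longrightarrow> src \<Lambda> (cmp \<Lambda> \<kappa> \<mu>) = src \<Lambda> \<mu>"
    and idm_left: "\<kappa> \<in> Mor \<Lambda> \<Longrightarrow> cmp \<Lambda> (idm \<Lambda> (rng \<Lambda> \<kappa>)) \<kappa> = \<kappa>"
    and idm_right: "\<kappa> \<in> Mor \<Lambda> \<Longrightarrow> cmp \<Lambda> \<kappa> (idm \<Lambda> (src \<Lambda> \<kappa>)) = \<kappa>"
    and cmp_assoc: "\<lbrakk>\<kappa> \<in> Mor \<Lambda>; \<mu> \<in> Mor \<Lambda>; \<nu> \<in> Mor \<Lambda>; src \<Lambda> \<kappa> = rng \<Lambda> \<mu>; src \<Lambda> \<mu> = rng \<Lambda> \<nu>\<rbrakk>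
      \<Longrightarrow> cmp \<Lambda> (cmp \<Lambda> \<kappa> \<mu>) \<nu> = cmp \<Lambda> \<kappa> (cmp \<Lambda> \<mu> \<nu>)"

locale k_graph = small_category +
  assumes countable_Mor: "countable (Mor \<Lambda>)"
    and degr_idm: "w \<in> Vert \<Lambda> \<Longrightarrow> degr \<Lambda> (idm \<Lambda> w) = 0"
    and degr_cmp: "\<lbrakk>\<kappa> \<in> Mor \<Lambda>; \<mu> \<in> Mor \<Lambda>; src \<Lambda> \<kappa> = rng \<Lambda> \<mu>\<rbrakk>
      \<Longrightarrow> degr \<Lambda> (cmp \<Lambda> \<kappa> \<mu>) = degr \<Lambda> \<kappa> + degr \<Lambda> \<mu>"
    and unique_factorization: "\<lbrakk>\<kappa> \<in> Mor \<Lambda>; degr \<Lambda> \<kappa> = n + m\<rbrakk>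
      \<Longrightarrow> \<exists>!p. case p of (\<alpha>, \<beta>) \<Rightarrow> \<alpha> \<in> Mor \<Lambda> \<and> \<beta> \<in> Mor \<Lambda> \<and> degr \<Lambda> \<alpha> = n \<and> degr \<Lambda> \<beta> = m
            \<and> src \<Lambda> \<alpha> = rng \<Lambda> \<beta> \<and> \<kappa> = cmp \<Lambda> \<alpha> \<beta>"

definition mor_from :: "('v, 'm, 'k::finite) kgraph \<Rightarrow> 'v \<Rightarrow> nat ^ 'k \<Rightarrow> 'm set"
  where "mor_from \<Lambda> u n = {\<kappa> \<in> Mor \<Lambda>. degr \<Lambda> \<kappa> = n \<and> rng \<Lambda> \<kappa> = u}"

definition row_finite_no_sources :: "('v, 'm, 'k::finite) kgraph \<Rightarrow> bool"
  where "row_finite_no_sources \<Lambda> \<longleftrightarrow>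
    (\<forall>u \<in> Vert \<Lambda>. \<forall>n. finite (mor_from \<Lambda> u n) \<and> mor_from \<Lambda> u n \<noteq> {})"

definition edges :: "('v, 'm, 'k::finite) kgraph \<Rightarrow> 'm set"
  where "edges \<Lambda> = (\<Union>i. {\<kappa> \<in> Mor \<Lambda>. degr \<Lambda> \<kappa> = axis i 1})"

section \<open>The talented monoid\<close>

text \<open>
  The free commutative monoid on the symbols \<open>w(n)\<close> is realised as the multisets over
  \<open>Vert \<Lambda> \<times> \<int>\<^sup>k\<close>; \<open>tal_cong\<close> is the congruence on it generated by the defining relations.
\<close>

definition tal_free :: "('v, 'm, 'k::finite) kgraph \<Rightarrow> ('v \<times> (int ^ 'k)) multiset set"
  where "tal_free \<Lambda> = {M. set_mset M \<subseteq> Vert \<Lambda> \<times> UNIV}"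

inductive tal_cong ::
  "('v, 'm, 'k::finite) kgraph \<Rightarrow> ('v \<times> (int ^ 'k)) multiset \<Rightarrow> ('v \<times> (int ^ 'k)) multiset \<Rightarrow> bool"
  for \<Lambda> :: "('v, 'm, 'k) kgraph"
  where
    rel: "w \<in> Vert \<Lambda> \<Longrightarrow>
      tal_cong \<Lambda> {#(w, n)#} {#(src \<Lambda> \<alpha>, n + axis i 1). \<alpha> \<in># mset_set (mor_from \<Lambda> w (axis i 1))#}"
  | refl: "M \<in> tal_free \<Lambda> \<Longrightarrow> tal_cong \<Lambda> M M"
  | sym: "tal_cong \<Lambda> M N \<Longrightarrow> tal_cong \<Lambda> N M"
  | trans: "\<lbrakk>tal_cong \<Lambda> L M; tal_cong \<Lambda> M N\<rbrakk> \<Longrightarrow> tal_cong \<Lambda> L N"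
  | add: "\<lbrakk>tal_cong \<Lambda> M N; tal_cong \<Lambda> M' N'\<rbrakk> \<Longrightarrow> tal_cong \<Lambda> (M + M') (N + N')"

definition tal_class ::
  "('v, 'm, 'k::finite) kgraph \<Rightarrow> ('v \<times> (int ^ 'k)) multiset \<Rightarrow> ('v \<times> (int ^ 'k)) multiset set"
  where "tal_class \<Lambda> M = {N. tal_cong \<Lambda> M N}"

definition talented_monoid ::
  "('v, 'm, 'k::finite) kgraph \<Rightarrow> ('v \<times> (int ^ 'k)) multiset set monoid"
  where "talented_monoid \<Lambda> =
    \<lparr>carrier = tal_class \<Lambda> ` tal_free \<Lambda>,
     mult = (\<lambda>X Y. \<Union>M\<in>X. \<Union>N\<in>Y. tal_class \<Lambda> (M + N)),
     one = tal_class \<Lambda> {#}\<rparr>"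

definition tal_gen ::
  "('v, 'm, 'k::finite) kgraph \<Rightarrow> 'v \<Rightarrow> int ^ 'k \<Rightarrow> ('v \<times> (int ^ 'k)) multiset set"
  where "tal_gen \<Lambda> w n = tal_class \<Lambda> {#(w, n)#}"

definition tal_act ::
  "('v, 'm, 'k::finite) kgraph \<Rightarrow> int ^ 'k
    \<Rightarrow> ('v \<times> (int ^ 'k)) multiset set \<Rightarrow> ('v \<times> (int ^ 'k)) multiset set"
  where "tal_act \<Lambda> m X = (\<Union>M\<in>X. tal_class \<Lambda> {#(w, n + m). (w, n) \<in># M#})"

definition monoid_homs :: "('a, 'x) monoid_scheme \<Rightarrow> ('b, 'y) monoid_scheme \<Rightarrow> ('a \<Rightarrow> 'b) set"
  where "monoid_homs G H = {h \<in> hom G H. h \<one>\<^bsub>G\<^esub> = \<one>\<^bsub>H\<^esub>}"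

definition tal_equivariant_isos ::
  "('v, 'm, 'k::finite) kgraph \<Rightarrow> ('w, 'n, 'k) kgraph
    \<Rightarrow> (('v \<times> (int ^ 'k)) multiset set \<Rightarrow> ('w \<times> (int ^ 'k)) multiset set) set"
  where "tal_equivariant_isos \<Lambda> \<Gamma> =
    {h \<in> monoid_homs (talented_monoid \<Lambda>) (talented_monoid \<Gamma>).
      bij_betw h (carrier (talented_monoid \<Lambda>)) (carrier (talented_monoid \<Gamma>)) \<and>
      (\<forall>m. \<forall>x \<in> carrier (talented_monoid \<Lambda>). h (tal_act \<Lambda> m x) = tal_act \<Gamma> m (h x))}"

section \<open>In-splits\<close>

definition insplit_partition ::
  "('v, 'm, 'k::finite) kgraph \<Rightarrow> 'v \<Rightarrow> 'm set \<Rightarrow> 'm set \<Rightarrow> bool"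
  where "insplit_partition \<Lambda> v E1 E2 \<longleftrightarrow>
    E1 \<union> E2 = {f \<in> edges \<Lambda>. rng \<Lambda> f = v} \<and> E1 \<inter> E2 = {} \<and> E1 \<noteq> {} \<and> E2 \<noteq> {} \<and>
    (\<forall>\<kappa> \<in> E1 \<union> E2. \<forall>\<mu> \<in> E1 \<union> E2.
      (\<exists>\<alpha> \<in> edges \<Lambda>. \<exists>\<beta> \<in> edges \<Lambda>. src \<Lambda> \<kappa> = rng \<Lambda> \<alpha> \<and> src \<Lambda> \<mu> = rng \<Lambda> \<beta> \<and>
        cmp \<Lambda> \<kappa> \<alpha> = cmp \<Lambda> \<mu> \<beta>)
      \<longrightarrow> (\<kappa> \<in> E1 \<and> \<mu> \<in> E1) \<or> (\<kappa> \<in> E2 \<and> \<mu> \<in> E2))"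

text \<open>
  \<open>Copy1 x\<close> and \<open>Copy2 x\<close> stand for \<open>x\<^sup>1\<close> and \<open>x\<^sup>2\<close>; \<open>Orig x\<close> is an element that is not split.
\<close>

datatype 'a split = Orig (par: 'a) | Copy1 (par: 'a) | Copy2 (par: 'a)

definition I_verts :: "('v, 'm, 'k::finite) kgraph \<Rightarrow> 'v \<Rightarrow> 'v split set"
  where "I_verts \<Lambda> v = Orig ` (Vert \<Lambda> - {v}) \<union> {Copy1 v, Copy2 v}"

definition I_edges :: "('v, 'm, 'k::finite) kgraph \<Rightarrow> 'v \<Rightarrow> 'm split set"
  where "I_edges \<Lambda> v =
    Orig ` {f \<in> edges \<Lambda>. src \<Lambda> f \<noteq> v} \<union>
    Copy1 ` {f \<in> edges \<Lambda>. src \<Lambda> f = v} \<union> Copy2 ` {f \<in> edges \<Lambda>. src \<Lambda> f = v}"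

text \<open>
  Only the first block \<open>E1\<close> of the partition is passed as an argument: an edge with range \<open>v\<close>
  that is not in \<open>E1\<close> lies in the second block.
\<close>

definition I_rng :: "('v, 'm, 'k::finite) kgraph \<Rightarrow> 'v \<Rightarrow> 'm set \<Rightarrow> 'm split \<Rightarrow> 'v split"
  where "I_rng \<Lambda> v E1 x =
    (if rng \<Lambda> (par x) \<noteq> v then Orig (rng \<Lambda> (par x))
     else if par x \<in> E1 then Copy1 v else Copy2 v)"

fun I_src :: "('v, 'm, 'k::finite) kgraph \<Rightarrow> 'v \<Rightarrow> 'm split \<Rightarrow> 'v split"
  where
    "I_src \<Lambda> v (Orig f) = Orig (src \<Lambda> f)"
  | "I_src \<Lambda> v (Copy1 f) = Copy1 v"
  | "I_src \<Lambda> v (Copy2 f) = Copy2 v"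

text \<open>
  An edge path is recorded as a triple (range, list of edges, source), so that the paths of
  length zero are the triples \<open>(u, [], u)\<close>.
\<close>

type_synonym ('v, 'm) epath = "'v split \<times> 'm split list \<times> 'v split"

fun is_epath ::
  "('v, 'm, 'k::finite) kgraph \<Rightarrow> 'v \<Rightarrow> 'm set \<Rightarrow> 'v split \<Rightarrow> 'm split list \<Rightarrow> 'v split \<Rightarrow> bool"
  where
    "is_epath \<Lambda> v E1 u [] w \<longleftrightarrow> u \<in> I_verts \<Lambda> v \<and> w = u"
  | "is_epath \<Lambda> v E1 u (x # xs) w \<longleftrightarrow>
      x \<in> I_edges \<Lambda> v \<and> I_rng \<Lambda> v E1 x = u \<and> is_epath \<Lambda> v E1 (I_src \<Lambda> v x) xs w"

definition epaths :: "('v, 'm, 'k::finite) kgraph \<Rightarrow> 'v \<Rightarrow> 'm set \<Rightarrow> ('v, 'm) epath set"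
  where "epaths \<Lambda> v E1 = {(u, xs, w). is_epath \<Lambda> v E1 u xs w}"

fun epath_par :: "('v, 'm, 'k::finite) kgraph \<Rightarrow> ('v, 'm) epath \<Rightarrow> 'm"
  where "epath_par \<Lambda> (u, xs, w) = foldr (\<lambda>x \<kappa>. cmp \<Lambda> (par x) \<kappa>) xs (idm \<Lambda> (par w))"

fun epath_degr :: "('v, 'm, 'k::finite) kgraph \<Rightarrow> ('v, 'm) epath \<Rightarrow> nat ^ 'k"
  where "epath_degr \<Lambda> (u, xs, w) = (\<Sum>x\<leftarrow>xs. degr \<Lambda> (par x))"

fun epath_append :: "('v, 'm) epath \<Rightarrow> ('v, 'm) epath \<Rightarrow> ('v, 'm) epath"
  where "epath_append (u, xs, w) (u', ys, w') = (u, xs @ ys, w')"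

definition epath_equiv ::
  "('v, 'm, 'k::finite) kgraph \<Rightarrow> 'v \<Rightarrow> 'm set \<Rightarrow> (('v, 'm) epath \<times> ('v, 'm) epath) set"
  where "epath_equiv \<Lambda> v E1 =
    {(p, q). p \<in> epaths \<Lambda> v E1 \<and> q \<in> epaths \<Lambda> v E1 \<and>
      fst p = fst q \<and> snd (snd p) = snd (snd q) \<and> epath_par \<Lambda> p = epath_par \<Lambda> q}"

text \<open>
  Range, source and degree of a class are the common values on its representatives, extracted
  by \<^const>\<open>the_elem\<close>.
\<close>

definition insplit ::
  "('v, 'm, 'k::finite) kgraph \<Rightarrow> 'v \<Rightarrow> 'm set \<Rightarrow> ('v split, ('v, 'm) epath set, 'k) kgraph"
  where "insplit \<Lambda> v E1 =
    \<lparr>Vert = I_verts \<Lambda> v,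
     Mor = epaths \<Lambda> v E1 // epath_equiv \<Lambda> v E1,
     rng = (\<lambda>X. the_elem (fst ` X)),
     src = (\<lambda>X. the_elem ((snd \<circ> snd) ` X)),
     idm = (\<lambda>u. epath_equiv \<Lambda> v E1 `` {(u, [], u)}),
     cmp = (\<lambda>X Y. \<Union>p\<in>X. \<Union>q\<in>Y. epath_equiv \<Lambda> v E1 `` {epath_append p q}),
     degr = (\<lambda>X. the_elem (epath_degr \<Lambda> ` X))\<rparr>"

text \<open>
  A monoid homomorphism out of \<open>talented_monoid \<Lambda>\<close> is determined by its values on the
  generators, so at most one map on the carrier satisfies the following predicate.
\<close>

definition is_insplit_map ::
  "('v, 'm, 'k::finite) kgraph \<Rightarrow> 'v \<Rightarrow> 'm set
    \<Rightarrow> (('v \<times> (int ^ 'k)) multiset set \<Rightarrow> ('v split \<times> (int ^ 'k)) multiset set) \<Rightarrow> bool"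
  where "is_insplit_map \<Lambda> v E1 \<phi> \<longleftrightarrow>
    \<phi> \<in> monoid_homs (talented_monoid \<Lambda>) (talented_monoid (insplit \<Lambda> v E1)) \<and>
    (\<forall>w \<in> Vert \<Lambda>. \<forall>n. \<phi> (tal_gen \<Lambda> w n) =
      (if w \<noteq> v then tal_gen (insplit \<Lambda> v E1) (Orig w) n
       else tal_gen (insplit \<Lambda> v E1) (Copy1 v) n
         \<otimes>\<^bsub>talented_monoid (insplit \<Lambda> v E1)\<^esub> tal_gen (insplit \<Lambda> v E1) (Copy2 v) n))"

end

theory Submission imports Defs begin

text \<open>
  On free commutative monoids, \<open>v(n) \<mapsto> v\<^sup>1(n) + v\<^sup>2(n)\<close> respects the defining relations because the
  edges of the in-split ending at \<open>v\<^sup>j\<close> are the copies of the edges in the block \<open>E\<^sub>j\<close>. For a fixed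
  colour \<open>c\<close>, an inverse sends \<open>v\<^sup>j(n)\<close> to the sum of \<open>s(f)(n + e\<^sub>c)\<close> over the edges \<open>f\<close> of
  colour \<open>c\<close> in \<open>E\<^sub>j\<close>. Modulo the relations this does not depend on \<open>c\<close>: expanding the sum
  once more in colour \<open>d\<close> gives a sum over the paths of degree \<open>e\<^sub>c + e\<^sub>d\<close> whose initial edge of
  colour \<open>c\<close> lies in \<open>E\<^sub>j\<close>, and by the pairing condition these are the paths whose initial edge
  of colour \<open>d\<close> lies in \<open>E\<^sub>j\<close>.
\<close>

text \<open>Degrees are compared with \<open>axis i 1\<close> over \<open>nat\<close>, which must not turn into \<open>axis i (Suc 0)\<close>.\<close>

declare One_nat_def [simp del]

section \<open>The talented monoid as a quotient\<close>

text \<open>The homomorphism of free commutative monoids that extends \<open>F\<close>.\<close>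

definition mset_extend :: "('a \<Rightarrow> 'b multiset) \<Rightarrow> 'a multiset \<Rightarrow> 'b multiset"
  where "mset_extend F M = (\<Sum>x\<in>#M. F x)"

lemma mset_extend_simps [simp]:
  "mset_extend F {#} = {#}"
  "mset_extend F (add_mset x M) = F x + mset_extend F M"
  "mset_extend F (M + N) = mset_extend F M + mset_extend F N"
  by (simp_all add: mset_extend_def)

lemma mset_extend_id: "mset_extend (\<lambda>x. {#x#}) M = M"
  by (induction M) simp_all

lemma mset_extend_image: "mset_extend F (image_mset f M) = mset_extend (F \<circ> f) M"
  by (induction M) simp_all

lemma mset_extend_compose: "mset_extend F (mset_extend G M) = mset_extend (mset_extend F \<circ> G) M"
  by (induction M) simp_all

lemma tal_free_simps [simp]:
  "{#} \<in> tal_free \<Lambda>"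
  "add_mset x M \<in> tal_free \<Lambda> \<longleftrightarrow> fst x \<in> Vert \<Lambda> \<and> M \<in> tal_free \<Lambda>"
  "M + N \<in> tal_free \<Lambda> \<longleftrightarrow> M \<in> tal_free \<Lambda> \<and> N \<in> tal_free \<Lambda>"
  by (auto simp: tal_free_def mem_Times_iff)

lemma mset_extend_tal_free:
  "(\<And>x. x \<in># M \<Longrightarrow> F x \<in> tal_free \<Lambda>) \<Longrightarrow> mset_extend F M \<in> tal_free \<Lambda>"
  by (induction M) auto

lemma tal_freeD: "M \<in> tal_free \<Lambda> \<Longrightarrow> x \<in># M \<Longrightarrow> fst x \<in> Vert \<Lambda>"
  by (auto simp: tal_free_def)

lemma tal_cong_extend:
  "(\<And>x. x \<in># M \<Longrightarrow> tal_cong \<Lambda> (F x) (G x)) \<Longrightarrow> tal_cong \<Lambda> (mset_extend F M) (mset_extend G M)"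
  by (induction M) (auto intro: tal_cong.add tal_cong.refl)

text \<open>The right-hand side of a defining relation, taken over an arbitrary \<open>S\<close> so
  that blocks and sets of longer paths fit too; \<open>n\<close> is the degree after the
  shift.\<close>

definition expand ::
  "('v, 'm, 'k::finite) kgraph \<Rightarrow> 'm set \<Rightarrow> int ^ 'k \<Rightarrow> ('v \<times> (int ^ 'k)) multiset"
  where "expand \<Lambda> S n = {#(src \<Lambda> \<alpha>, n). \<alpha> \<in># mset_set S#}"

lemma tal_cong_rel:
  "w \<in> Vert \<Lambda> \<Longrightarrow> tal_cong \<Lambda> {#(w, n)#} (expand \<Lambda> (mor_from \<Lambda> w (axis i 1)) (n + axis i 1))"
  unfolding expand_def by (rule tal_cong.rel)

text \<open>Universal property of the quotient: the congruence is generated by the relations, so a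
  homomorphism only has to respect those. It serves the map and its inverse alike.\<close>

lemma tal_cong_mset_extend:
  assumes "tal_cong \<Lambda> M N"
    and "\<And>w n. w \<in> Vert \<Lambda> \<Longrightarrow> F (w, n) \<in> tal_free \<Gamma>"
    and "\<And>w n i. w \<in> Vert \<Lambda> \<Longrightarrow>
      tal_cong \<Gamma> (F (w, n)) (mset_extend F (expand \<Lambda> (mor_from \<Lambda> w (axis i 1)) (n + axis i 1)))"
  shows "tal_cong \<Gamma> (mset_extend F M) (mset_extend F N)"
  using assms(1)
proof induction
  case (rel w n i)
  then show ?case using assms(3)[of w n i] by (simp add: expand_def)
next
  case (refl M)
  then show ?case
    by (auto intro!: tal_cong.refl mset_extend_tal_free assms(2) dest: tal_freeD)
qed (auto intro: tal_cong.sym tal_cong.trans tal_cong.add)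

section \<open>The translation action on representatives\<close>

definition shift :: "int ^ 'k \<Rightarrow> ('v \<times> (int ^ 'k::finite)) multiset \<Rightarrow> ('v \<times> (int ^ 'k)) multiset"
  where "shift m M = {#(w, n + m). (w, n) \<in># M#}"

lemma shift_simps [simp]:
  "shift m {#} = {#}"
  "shift m (add_mset (w, n) M) = add_mset (w, n + m) (shift m M)"
  "shift m (M + N) = shift m M + shift m N"
  by (simp_all add: shift_def)

lemma shift_tal_free [simp]: "shift m M \<in> tal_free \<Lambda> \<longleftrightarrow> M \<in> tal_free \<Lambda>"
  by (induction M) (auto simp: shift_def)

lemma shift_expand: "shift m (expand \<Lambda> S n) = expand \<Lambda> S (n + m)"
  by (simp add: shift_def expand_def multiset.map_comp comp_def)

lemma tal_cong_shift: "tal_cong \<Lambda> M N \<Longrightarrow> tal_cong \<Lambda> (shift m M) (shift m N)"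
proof (induction rule: tal_cong.induct)
  case (rel w n i)
  then show ?case
    using tal_cong_rel[of w \<Lambda> "n + m" i] shift_expand[of m \<Lambda> _ "n + axis i 1"]
    by (simp add: expand_def add_ac)
qed (auto intro: tal_cong.intros)

lemma shift_mset_extend:
  assumes "\<And>w n. F (w, n + m) = shift m (F (w, n))"
  shows "shift m (mset_extend F M) = mset_extend F (shift m M)"
  by (induction M) (auto simp: assms)

text \<open>The assumption keeps the relations inside \<open>tal_free\<close>. Both
  \<open>\<Lambda>\<close> and its in-split become instances.\<close>

locale talented =
  fixes \<Lambda> :: "('v, 'm, 'k::finite) kgraph"
  assumes src_Vert: "w \<in> Vert \<Lambda> \<Longrightarrow> \<alpha> \<in> mor_from \<Lambda> w (axis i 1) \<Longrightarrow> src \<Lambda> \<alpha> \<in> Vert \<Lambda>"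
begin

lemma tal_cong_free: "tal_cong \<Lambda> M N \<Longrightarrow> M \<in> tal_free \<Lambda> \<and> N \<in> tal_free \<Lambda>"
proof (induction rule: tal_cong.induct)
  case (rel w n i)
  then show ?case
    using src_Vert[OF rel, of _ i]
    \<comment> \<open>For an infinite set \<open>mset_set\<close> is empty, and the empty multiset
      also lies in \<open>tal_free\<close>.\<close>
    by (cases "finite (mor_from \<Lambda> w (axis i 1))") (auto simp: tal_free_def)
qed auto

lemma tal_class_eq_iff:
  "M \<in> tal_free \<Lambda> \<Longrightarrow> tal_class \<Lambda> M = tal_class \<Lambda> N \<longleftrightarrow> tal_cong \<Lambda> M N"
  unfolding tal_class_def
  by (metis (no_types, lifting) Collect_cong mem_Collect_eq tal_cong.refl tal_cong.sym tal_cong.trans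
      tal_cong_free)

lemma mem_tal_class: "N \<in> tal_class \<Lambda> M \<longleftrightarrow> tal_cong \<Lambda> M N"
  by (simp add: tal_class_def)

lemma tal_class_self: "M \<in> tal_free \<Lambda> \<Longrightarrow> M \<in> tal_class \<Lambda> M"
  by (simp add: mem_tal_class tal_cong.refl)

text \<open>Product, action and the map below are unions over representatives. The class contains
  \<open>M\<close>, so a union of equal terms collapses to their common value.\<close>

lemma UN_tal_class:
  assumes "M \<in> tal_free \<Lambda>" "\<And>N. tal_cong \<Lambda> M N \<Longrightarrow> F N = A"
  shows "(\<Union>N\<in>tal_class \<Lambda> M. F N) = A"
  using assms tal_class_self[OF assms(1)] by (intro SUP_eq_const) (auto simp: mem_tal_class)

lemma mult_tal_class:
  assumes "M \<in> tal_free \<Lambda>" "N \<in> tal_free \<Lambda>"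
  shows "tal_class \<Lambda> M \<otimes>\<^bsub>talented_monoid \<Lambda>\<^esub> tal_class \<Lambda> N = tal_class \<Lambda> (M + N)"
proof -
  have eq: "tal_class \<Lambda> (M' + N') = tal_class \<Lambda> (M + N)"
    if "tal_cong \<Lambda> M M'" "tal_cong \<Lambda> N N'" for M' N'
    using that assms by (metis tal_class_eq_iff tal_cong.add tal_free_simps(3))
  have "(\<Union>M'\<in>tal_class \<Lambda> M. \<Union>N'\<in>tal_class \<Lambda> N. tal_class \<Lambda> (M' + N')) = tal_class \<Lambda> (M + N)"
    by (intro UN_tal_class assms eq)
  then show ?thesis by (simp add: talented_monoid_def)
qed

lemma tal_act_tal_class:
  "M \<in> tal_free \<Lambda> \<Longrightarrow> tal_act \<Lambda> m (tal_class \<Lambda> M) = tal_class \<Lambda> (shift m M)"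
  unfolding tal_act_def shift_def[symmetric]
  by (rule UN_tal_class) (metis shift_tal_free tal_class_eq_iff tal_cong_shift)+

end

lemma carrier_talented: "carrier (talented_monoid \<Lambda>) = tal_class \<Lambda> ` tal_free \<Lambda>"
  and one_talented: "\<one>\<^bsub>talented_monoid \<Lambda>\<^esub> = tal_class \<Lambda> {#}"
  by (simp_all add: talented_monoid_def)

section \<open>The in-split graph\<close>

context k_graph
begin

lemma factorization_unique:
  assumes "\<alpha> \<in> Mor \<Lambda>" "\<beta> \<in> Mor \<Lambda>" "src \<Lambda> \<alpha> = rng \<Lambda> \<beta>"
    and "\<alpha>' \<in> Mor \<Lambda>" "\<beta>' \<in> Mor \<Lambda>" "src \<Lambda> \<alpha>' = rng \<Lambda> \<beta>'"
    and "degr \<Lambda> \<alpha> = degr \<Lambda> \<alpha>'" "degr \<Lambda> \<beta> = degr \<Lambda> \<beta>'" "cmp \<Lambda> \<alpha> \<beta> = cmp \<Lambda> \<alpha>' \<beta>'"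
  shows "\<alpha> = \<alpha>' \<and> \<beta> = \<beta>'"
proof -
  \<comment> \<open>The predicate of \<open>unique_factorization\<close>, with the degrees of the
    first pair as the prescribed ones.\<close>
  define P where "P = (\<lambda>(\<gamma>, \<delta>). \<gamma> \<in> Mor \<Lambda> \<and> \<delta> \<in> Mor \<Lambda> \<and> degr \<Lambda> \<gamma> = degr \<Lambda> \<alpha> \<and>
    degr \<Lambda> \<delta> = degr \<Lambda> \<beta> \<and> src \<Lambda> \<gamma> = rng \<Lambda> \<delta> \<and> cmp \<Lambda> \<alpha> \<beta> = cmp \<Lambda> \<gamma> \<delta>)"
  have "cmp \<Lambda> \<alpha> \<beta> \<in> Mor \<Lambda>" "degr \<Lambda> (cmp \<Lambda> \<alpha> \<beta>) = degr \<Lambda> \<alpha> + degr \<Lambda> \<beta>"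
    by (rule cmp_closed[OF assms(1-3)], rule degr_cmp[OF assms(1-3)])
  from unique_factorization[OF this] have "\<exists>!p. P p"
    unfolding P_def .
  moreover have "P (\<alpha>, \<beta>)" "P (\<alpha>', \<beta>')" using assms by (simp_all add: P_def)
  ultimately have "(\<alpha>, \<beta>) = (\<alpha>', \<beta>')" by blast
  then show ?thesis by simp
qed

end

locale insplit_data = k_graph \<Lambda> for \<Lambda> :: "('v, 'm, 'k::finite) kgraph" +
  fixes v :: 'v and E1 E2 :: "'m set"
  assumes rfns: "row_finite_no_sources \<Lambda>"
    and v_Vert: "v \<in> Vert \<Lambda>"
    and partition: "insplit_partition \<Lambda> v E1 E2"
begin

abbreviation "\<Lambda>\<^sub>I \<equiv> insplit \<Lambda> v E1"

lemma finite_mor_from: "u \<in> Vert \<Lambda> \<Longrightarrow> finite (mor_from \<Lambda> u n)"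
  using rfns by (auto simp: row_finite_no_sources_def)

lemma edges_iff: "f \<in> edges \<Lambda> \<longleftrightarrow> f \<in> Mor \<Lambda> \<and> (\<exists>i. degr \<Lambda> f = axis i 1)"
  by (auto simp: edges_def)

lemma block_union: "E1 \<union> E2 = {f \<in> edges \<Lambda>. rng \<Lambda> f = v}" and block_disjoint: "E1 \<inter> E2 = {}"
  using partition by (auto simp: insplit_partition_def)

lemma I_edges_iff:
  "x \<in> I_edges \<Lambda> v \<longleftrightarrow> par x \<in> edges \<Lambda> \<and> (case x of Orig f \<Rightarrow> src \<Lambda> f \<noteq> v | _ \<Rightarrow> src \<Lambda> (par x) = v)"
  by (cases x) (auto simp: I_edges_def)

lemma I_src_props:
  assumes "x \<in> I_edges \<Lambda> v"
  shows "I_src \<Lambda> v x \<in> I_verts \<Lambda> v" "par (I_src \<Lambda> v x) = src \<Lambda> (par x)"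
  using assms by (cases x; auto simp: I_edges_iff I_verts_def edges_iff src_closed)+

lemma I_rng_props:
  assumes "x \<in> I_edges \<Lambda> v"
  shows "I_rng \<Lambda> v E1 x \<in> I_verts \<Lambda> v" "par (I_rng \<Lambda> v E1 x) = rng \<Lambda> (par x)"
  using assms by (auto simp: I_edges_iff I_verts_def I_rng_def edges_iff rng_closed)

text \<open>The two copies of an edge share parent and range; only their sources tell them
  apart.\<close>

lemma I_edge_eqI:
  assumes "x \<in> I_edges \<Lambda> v" "y \<in> I_edges \<Lambda> v" "par x = par y" "I_src \<Lambda> v x = I_src \<Lambda> v y"
  shows "x = y"
  using assms by (cases x; cases y) (auto simp: I_edges_iff)

lemma I_verts_Vert: "u \<in> I_verts \<Lambda> v \<Longrightarrow> par u \<in> Vert \<Lambda>"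
  using v_Vert by (auto simp: I_verts_def)

text \<open>Since \<open>par\<close> commutes with range and source, parents of consecutive edges
  are composable. The last conjunct makes the degree a function of the parent.\<close>

lemma epath_props:
  "is_epath \<Lambda> v E1 u xs w \<Longrightarrow>
    u \<in> I_verts \<Lambda> v \<and> w \<in> I_verts \<Lambda> v \<and> epath_par \<Lambda> (u, xs, w) \<in> Mor \<Lambda> \<and>
    rng \<Lambda> (epath_par \<Lambda> (u, xs, w)) = par u \<and>
    degr \<Lambda> (epath_par \<Lambda> (u, xs, w)) = epath_degr \<Lambda> (u, xs, w)"
proof (induction xs arbitrary: u)
  case Nil
  then show ?case
    by (auto simp: idm_closed rng_idm degr_idm I_verts_Vert)
next
  case (Cons x xs)
  then have x: "x \<in> I_edges \<Lambda> v" "I_rng \<Lambda> v E1 x = u" and "is_epath \<Lambda> v E1 (I_src \<Lambda> v x) xs w"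
    by auto
  note IH = Cons.IH[OF this(3)]
  have "par x \<in> Mor \<Lambda>" using x by (auto simp: I_edges_iff edges_iff)
  then show ?case
    using IH x I_src_props[OF x(1)] I_rng_props[OF x(1)]
    by (auto simp: cmp_closed rng_cmp degr_cmp)
qed

lemma epath_degr_eq: "p \<in> epaths \<Lambda> v E1 \<Longrightarrow> degr \<Lambda> (epath_par \<Lambda> p) = epath_degr \<Lambda> p"
  unfolding epaths_def using epath_props by blast

section \<open>Edges of the in-split as classes of one-edge paths\<close>

abbreviation edge_class :: "'m split \<Rightarrow> ('v, 'm) epath set" where
  "edge_class x \<equiv> epath_equiv \<Lambda> v E1 `` {(I_rng \<Lambda> v E1 x, [x], I_src \<Lambda> v x)}"

lemma single_epath: "x \<in> I_edges \<Lambda> v \<Longrightarrow> (I_rng \<Lambda> v E1 x, [x], I_src \<Lambda> v x) \<in> epaths \<Lambda> v E1"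
  by (simp add: epaths_def I_src_props)

text \<open>Equivalent paths share range, source and parent, and the parent determines the degree;
  hence each \<open>the_elem\<close> is taken of a singleton.\<close>

lemma epath_class_attributes:
  assumes "p \<in> epaths \<Lambda> v E1"
  defines "X \<equiv> epath_equiv \<Lambda> v E1 `` {p}"
  shows "X \<in> Mor \<Lambda>\<^sub>I" "rng \<Lambda>\<^sub>I X = fst p" "src \<Lambda>\<^sub>I X = snd (snd p)" "degr \<Lambda>\<^sub>I X = epath_degr \<Lambda> p"
proof -
  have pX: "p \<in> X" using assms by (auto simp: epath_equiv_def)
  have X_D: "q \<in> epaths \<Lambda> v E1" "fst q = fst p" "snd (snd q) = snd (snd p)"
    "epath_par \<Lambda> q = epath_par \<Lambda> p" if "q \<in> X" for q
    using that unfolding X_def epath_equiv_def by simp_all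
  have degr_eq: "epath_degr \<Lambda> q = epath_degr \<Lambda> p" if "q \<in> X" for q
    using epath_degr_eq[OF X_D(1)[OF that]] epath_degr_eq[OF assms(1)] X_D(4)[OF that] by simp
  have ne: "X \<noteq> {}" using pX by blast
  have "the_elem (fst ` X) = fst p"
    using ne X_D(2) by (rule the_elem_image_unique)
  then show "rng \<Lambda>\<^sub>I X = fst p" by (simp add: insplit_def)
  have "the_elem ((snd \<circ> snd) ` X) = snd (snd p)"
    using ne by (rule the_elem_image_unique) (simp only: comp_apply X_D(3))
  then show "src \<Lambda>\<^sub>I X = snd (snd p)" by (simp add: insplit_def)
  have "the_elem (epath_degr \<Lambda> ` X) = epath_degr \<Lambda> p"
    using ne degr_eq by (rule the_elem_image_unique)
  then show "degr \<Lambda>\<^sub>I X = epath_degr \<Lambda> p" by (simp add: insplit_def)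
  show "X \<in> Mor \<Lambda>\<^sub>I"
    using assms by (simp add: insplit_def X_def quotientI)
qed

text \<open>Every edge adds a unit vector, so a path of degree \<open>axis i 1\<close> consists of
  exactly one edge.\<close>

lemma epath_length:
  assumes "is_epath \<Lambda> v E1 u xs w"
  shows "(\<Sum>i\<in>UNIV. epath_degr \<Lambda> (u, xs, w) $ i) = length xs"
  using assms
proof (induction xs arbitrary: u)
  case (Cons x xs)
  then obtain i where "degr \<Lambda> (par x) = axis i 1"
    by (auto simp: I_edges_iff edges_iff)
  with Cons show ?case
    by (auto simp: sum.distrib axis_def)
qed simp

lemma mor_from_insplit:
  "mor_from \<Lambda>\<^sub>I u (axis i 1) =
    edge_class ` {x \<in> I_edges \<Lambda> v. I_rng \<Lambda> v E1 x = u \<and> degr \<Lambda> (par x) = axis i 1}" (is "?L = ?R")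
proof
  show "?R \<subseteq> ?L"
    using epath_class_attributes[OF single_epath] by (auto simp: mor_from_def)
  show "?L \<subseteq> ?R"
  proof
    fix X assume X: "X \<in> ?L"
    then obtain p where p: "p \<in> epaths \<Lambda> v E1" "X = epath_equiv \<Lambda> v E1 `` {p}"
      by (auto simp: mor_from_def insplit_def elim: quotientE)
    obtain u' xs w where pe: "p = (u', xs, w)" by (cases p)
    have path: "is_epath \<Lambda> v E1 u' xs w" using p pe by (simp add: epaths_def)
    have attr: "u' = u" "epath_degr \<Lambda> (u', xs, w) = axis i 1"
      using X epath_class_attributes[OF p(1)] pe by (auto simp: p(2) mor_from_def)
    have "length xs = 1"
      using epath_length[OF path] attr by (simp add: axis_def)
    then obtain x where "xs = [x]" by (auto simp: One_nat_def length_Suc_conv)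
    then show "X \<in> ?R" using path attr pe p by auto
  qed
qed

text \<open>Distinct edges are never identified in the path category, so sums over morphisms can be
  computed over edges with correct multiplicities.\<close>

lemma inj_edge_class: "inj_on edge_class (I_edges \<Lambda> v)"
proof
  fix x y assume xy: "x \<in> I_edges \<Lambda> v" "y \<in> I_edges \<Lambda> v" "edge_class x = edge_class y"
  have "(I_rng \<Lambda> v E1 y, [y], I_src \<Lambda> v y) \<in> edge_class x"
    unfolding xy(3) using single_epath[OF xy(2)] by (simp add: epath_equiv_def)
  then have src_eq: "I_src \<Lambda> v x = I_src \<Lambda> v y"
    and par_eq: "cmp \<Lambda> (par x) (idm \<Lambda> (par (I_src \<Lambda> v x))) =
      cmp \<Lambda> (par y) (idm \<Lambda> (par (I_src \<Lambda> v y)))"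
    by (auto simp: epath_equiv_def)
  have "par x = par y"
    using par_eq xy(1,2) I_src_props by (auto simp: idm_right I_edges_iff edges_iff)
  with src_eq xy show "x = y" by (blast intro: I_edge_eqI)
qed

section \<open>The map on free monoids and the relations of the in-split\<close>

fun split_gen :: "'v \<times> (int ^ 'k) \<Rightarrow> ('v split \<times> (int ^ 'k)) multiset" where
  "split_gen (w, n) = (if w \<noteq> v then {#(Orig w, n)#} else {#(Copy1 v, n), (Copy2 v, n)#})"

abbreviation "split_mset \<equiv> mset_extend split_gen"

lemma finite_I_edges_over: "finite S \<Longrightarrow> finite {x \<in> I_edges \<Lambda> v. par x \<in> S}"
  by (rule finite_subset[of _ "Orig ` S \<union> Copy1 ` S \<union> Copy2 ` S"])
    (auto simp: I_edges_def)

lemma I_edges_over: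
  assumes "finite S" "S \<subseteq> edges \<Lambda>"
  shows "{#(I_src \<Lambda> v x, n). x \<in># mset_set {x \<in> I_edges \<Lambda> v. par x \<in> S}#} =
    split_mset (expand \<Lambda> S n)"
  using assms
proof (induction S rule: finite_induct)
  case (insert f S)
  let ?A = "if src \<Lambda> f = v then {Copy1 f, Copy2 f} else {Orig f}"
  have "x \<in> {x \<in> I_edges \<Lambda> v. par x \<in> insert f S} \<longleftrightarrow>
      x \<in> ?A \<union> {x \<in> I_edges \<Lambda> v. par x \<in> S}" for x
    using insert by (cases x) (auto simp: I_edges_iff)
  then have eq: "{x \<in> I_edges \<Lambda> v. par x \<in> insert f S} = ?A \<union> {x \<in> I_edges \<Lambda> v. par x \<in> S}"
    by blast
  have "mset_set {x \<in> I_edges \<Lambda> v. par x \<in> insert f S} =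
      mset_set ?A + mset_set {x \<in> I_edges \<Lambda> v. par x \<in> S}"
    unfolding eq using insert by (intro mset_set_Union finite_I_edges_over) auto
  then show ?case
    using insert by (simp add: expand_def)
qed (simp add: expand_def)

text \<open>Here \<open>S\<close> collects the parents of the edges of colour \<open>i\<close> with
  range \<open>u\<close>, so the relation at \<open>u\<close> becomes the split of a sum in
  \<open>\<Lambda>\<close>.\<close>

lemma expand_insplit:
  assumes "finite S" "S \<subseteq> edges \<Lambda>"
    and S: "\<And>x. x \<in> I_edges \<Lambda> v \<Longrightarrow>
      par x \<in> S \<longleftrightarrow> I_rng \<Lambda> v E1 x = u \<and> degr \<Lambda> (par x) = axis i 1"
  shows "expand \<Lambda>\<^sub>I (mor_from \<Lambda>\<^sub>I u (axis i 1)) n = split_mset (expand \<Lambda> S n)"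
proof -
  let ?B = "{x \<in> I_edges \<Lambda> v. par x \<in> S}"
  have mor: "mor_from \<Lambda>\<^sub>I u (axis i 1) = edge_class ` ?B"
    unfolding mor_from_insplit using S by (intro image_cong) auto
  have "mset_set (edge_class ` ?B) = image_mset edge_class (mset_set ?B)"
    by (rule image_mset_mset_set[symmetric]) (rule inj_on_subset[OF inj_edge_class], auto)
  moreover have "src \<Lambda>\<^sub>I (edge_class x) = I_src \<Lambda> v x" if "x \<in># mset_set ?B" for x
    using that epath_class_attributes(3)[OF single_epath] assms(1)
    by (simp add: finite_I_edges_over)
  moreover have "{#(src \<Lambda>\<^sub>I (edge_class x), n). x \<in># mset_set ?B#} =
      {#(I_src \<Lambda> v x, n). x \<in># mset_set ?B#}"
    using calculation(2) by (intro image_mset_cong) simp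
  ultimately have "expand \<Lambda>\<^sub>I (mor_from \<Lambda>\<^sub>I u (axis i 1)) n = {#(I_src \<Lambda> v x, n). x \<in># mset_set ?B#}"
    unfolding expand_def mor by (simp add: multiset.map_comp comp_def)
  then show ?thesis using I_edges_over[OF assms(1,2)] by simp
qed

section \<open>Blocks of the partition, colour by colour\<close>

definition block :: "'m set \<Rightarrow> 'k \<Rightarrow> 'm set"
  where "block E i = {f \<in> E. degr \<Lambda> f = axis i 1}"

lemma block_Un: "block E1 i \<union> block E2 i = mor_from \<Lambda> v (axis i 1)"
  using block_union by (auto simp: block_def mor_from_def edges_iff)

lemma block_props:
  assumes "E = E1 \<or> E = E2"
  shows "finite (block E i)" "block E i \<subseteq> edges \<Lambda>"
    "\<And>f. f \<in> block E i \<Longrightarrow> rng \<Lambda> f = v"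
proof -
  have sub: "block E i \<subseteq> mor_from \<Lambda> v (axis i 1)" using block_Un[of i] assms by auto
  then show "finite (block E i)" using finite_mor_from v_Vert finite_subset by blast
  show "block E i \<subseteq> edges \<Lambda>" "\<And>f. f \<in> block E i \<Longrightarrow> rng \<Lambda> f = v"
    using sub unfolding mor_from_def edges_def by blast+
qed

lemma block_Mor: "E = E1 \<or> E = E2 \<Longrightarrow> f \<in> block E i \<Longrightarrow> f \<in> Mor \<Lambda>"
  using block_props(2)[of E i] edges_iff by blast

lemma block_src: "E = E1 \<or> E = E2 \<Longrightarrow> f \<in> block E i \<Longrightarrow> src \<Lambda> f \<in> Vert \<Lambda>"
  by (intro src_closed block_Mor)

lemma expand_mor_from_v:
  "expand \<Lambda> (mor_from \<Lambda> v (axis i 1)) n = expand \<Lambda> (block E1 i) n + expand \<Lambda> (block E2 i) n"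
  unfolding block_Un[symmetric] expand_def
  using block_disjoint by (subst mset_set_Union) (auto simp: block_props, auto simp: block_def)

lemma expand_insplit_Orig:
  assumes "w \<in> Vert \<Lambda>" "w \<noteq> v"
  shows "expand \<Lambda>\<^sub>I (mor_from \<Lambda>\<^sub>I (Orig w) (axis i 1)) n =
    split_mset (expand \<Lambda> (mor_from \<Lambda> w (axis i 1)) n)"
  using assms
  by (intro expand_insplit finite_mor_from) (auto simp: mor_from_def edges_iff I_rng_def I_edges_iff)

text \<open>\<open>I_rng\<close> tests membership in \<open>E1\<close> only; the claim for
  \<open>E2\<close> uses that the blocks are disjoint and exhaust the edges with range
  \<open>v\<close>.\<close>

lemma I_rng_Copy:
  assumes "x \<in> I_edges \<Lambda> v"
  shows "I_rng \<Lambda> v E1 x = Copy1 v \<longleftrightarrow> par x \<in> E1" "I_rng \<Lambda> v E1 x = Copy2 v \<longleftrightarrow> par x \<in> E2"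
proof -
  have "par x \<in> edges \<Lambda>" using assms by (simp add: I_edges_iff)
  then have "rng \<Lambda> (par x) = v \<longleftrightarrow> par x \<in> E1 \<or> par x \<in> E2" using block_union by blast
  moreover have "\<not> (par x \<in> E1 \<and> par x \<in> E2)" using block_disjoint by blast
  ultimately show "I_rng \<Lambda> v E1 x = Copy1 v \<longleftrightarrow> par x \<in> E1" "I_rng \<Lambda> v E1 x = Copy2 v \<longleftrightarrow> par x \<in> E2"
    unfolding I_rng_def by auto
qed

lemma expand_insplit_Copy1:
  "expand \<Lambda>\<^sub>I (mor_from \<Lambda>\<^sub>I (Copy1 v) (axis i 1)) n = split_mset (expand \<Lambda> (block E1 i) n)"
  by (rule expand_insplit) (simp_all add: block_props I_rng_Copy, simp add: block_def)

lemma expand_insplit_Copy2: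
  "expand \<Lambda>\<^sub>I (mor_from \<Lambda>\<^sub>I (Copy2 v) (axis i 1)) n = split_mset (expand \<Lambda> (block E2 i) n)"
  by (rule expand_insplit) (simp_all add: block_props I_rng_Copy, simp add: block_def)

lemma Vert_insplit: "Vert \<Lambda>\<^sub>I = I_verts \<Lambda> v"
  by (simp add: insplit_def)

sublocale T: talented \<Lambda>
  by unfold_locales (auto simp: mor_from_def src_closed)

sublocale TI: talented \<Lambda>\<^sub>I
proof
  fix u \<alpha> i assume "\<alpha> \<in> mor_from \<Lambda>\<^sub>I u (axis i 1)"
  then show "src \<Lambda>\<^sub>I \<alpha> \<in> Vert \<Lambda>\<^sub>I"
    unfolding mor_from_insplit Vert_insplit
    using epath_class_attributes(3)[OF single_epath] I_src_props by auto
qed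

section \<open>The homomorphism and its inverse\<close>

lemma split_gen_free: "w \<in> Vert \<Lambda> \<Longrightarrow> split_gen (w, n) \<in> tal_free \<Lambda>\<^sub>I"
  by (auto simp: Vert_insplit I_verts_def)

lemma split_mset_free: "M \<in> tal_free \<Lambda> \<Longrightarrow> split_mset M \<in> tal_free \<Lambda>\<^sub>I"
  by (rule mset_extend_tal_free) (metis prod.collapse split_gen_free tal_freeD)

text \<open>The relation at \<open>w\<close> other than \<open>v\<close> goes to the relation at
  \<open>Orig w\<close>; the one at \<open>v\<close> goes to the sum of the relations at the two
  copies.\<close>

lemma tal_cong_split_gen:
  assumes "w \<in> Vert \<Lambda>"
  shows "tal_cong \<Lambda>\<^sub>I (split_gen (w, n))
    (split_mset (expand \<Lambda> (mor_from \<Lambda> w (axis i 1)) (n + axis i 1)))"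
proof (cases "w = v")
  case False
  with assms have "Orig w \<in> Vert \<Lambda>\<^sub>I" by (simp add: Vert_insplit I_verts_def)
  from tal_cong_rel[OF this] False show ?thesis
    by (simp add: expand_insplit_Orig[OF assms, symmetric])
next
  case True
  have "Copy1 v \<in> Vert \<Lambda>\<^sub>I" "Copy2 v \<in> Vert \<Lambda>\<^sub>I" by (simp_all add: Vert_insplit I_verts_def)
  from tal_cong.add[OF tal_cong_rel[OF this(1), of n i] tal_cong_rel[OF this(2), of n i]] True
  show ?thesis
    by (simp add: add_mset_commute expand_mor_from_v expand_insplit_Copy1[symmetric] expand_insplit_Copy2[symmetric])
qed

lemma tal_cong_split_mset:
  "tal_cong \<Lambda> M N \<Longrightarrow> tal_cong \<Lambda>\<^sub>I (split_mset M) (split_mset N)"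
  by (erule tal_cong_mset_extend) (rule split_gen_free tal_cong_split_gen, assumption)+

section \<open>Two-step paths and independence of the colour\<close>

lemma pairing:
  assumes E: "E = E1 \<or> E = E2" and "\<kappa> \<in> E" "\<mu> \<in> edges \<Lambda>" "rng \<Lambda> \<mu> = v"
    and "\<alpha> \<in> edges \<Lambda>" "\<beta> \<in> edges \<Lambda>" "src \<Lambda> \<kappa> = rng \<Lambda> \<alpha>" "src \<Lambda> \<mu> = rng \<Lambda> \<beta>"
    and "cmp \<Lambda> \<kappa> \<alpha> = cmp \<Lambda> \<mu> \<beta>"
  shows "\<mu> \<in> E"
proof -
  have "\<kappa> \<in> E1 \<union> E2" "\<mu> \<in> E1 \<union> E2" using assms(1-4) block_union by blast+
  then have "(\<kappa> \<in> E1 \<and> \<mu> \<in> E1) \<or> (\<kappa> \<in> E2 \<and> \<mu> \<in> E2)"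
    using partition assms(5-9) unfolding insplit_partition_def by blast
  \<comment> \<open>The pairing condition only yields a common block; disjointness identifies it as
    \<open>E\<close>.\<close>
  with E \<open>\<kappa> \<in> E\<close> block_disjoint show ?thesis by auto
qed

text \<open>Pairs are kept uncomposed so that the set matches expanding twice, first in colour
  \<open>i\<close>, then in colour \<open>j\<close>.\<close>

definition two_step :: "'m set \<Rightarrow> 'k \<Rightarrow> 'k \<Rightarrow> ('m \<times> 'm) set"
  where "two_step E i j = (SIGMA f:block E i. mor_from \<Lambda> (src \<Lambda> f) (axis j 1))"

lemma two_step_iff:
  assumes "E = E1 \<or> E = E2"
  shows "(f, g) \<in> two_step E i j \<longleftrightarrow> f \<in> Mor \<Lambda> \<and> g \<in> Mor \<Lambda> \<and> src \<Lambda> f = rng \<Lambda> g \<and>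
    f \<in> E \<and> degr \<Lambda> f = axis i 1 \<and> degr \<Lambda> g = axis j 1"
  using block_Mor[OF assms] by (auto simp: two_step_def block_def mor_from_def)

lemma two_step_comp_subset:
  assumes E: "E = E1 \<or> E = E2"
  shows "case_prod (cmp \<Lambda>) ` two_step E i j \<subseteq> case_prod (cmp \<Lambda>) ` two_step E j i"
proof
  fix \<kappa> assume "\<kappa> \<in> case_prod (cmp \<Lambda>) ` two_step E i j"
  then obtain f g where "(f, g) \<in> two_step E i j" and \<kappa>: "\<kappa> = cmp \<Lambda> f g"
    by auto
  then have f: "f \<in> Mor \<Lambda>" "f \<in> E" "degr \<Lambda> f = axis i 1"
    and g: "g \<in> Mor \<Lambda>" "degr \<Lambda> g = axis j 1" "src \<Lambda> f = rng \<Lambda> g"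
    by (simp_all add: two_step_iff[OF E])
  have "f \<in> block E i" using f by (simp add: block_def)
  then have rng_f: "rng \<Lambda> f = v" by (rule block_props(3)[OF E])
  \<comment> \<open>The sum is written with \<open>axis j 1\<close> first so that the factorization
    starts with colour \<open>j\<close>.\<close>
  have "\<kappa> \<in> Mor \<Lambda>" "degr \<Lambda> \<kappa> = axis j 1 + axis i 1"
    unfolding \<kappa> using f g by (simp_all add: cmp_closed degr_cmp add.commute)
  from unique_factorization[OF this] obtain f' g' where f':
    "f' \<in> Mor \<Lambda>" "g' \<in> Mor \<Lambda>" "degr \<Lambda> f' = axis j 1" "degr \<Lambda> g' = axis i 1"
    "src \<Lambda> f' = rng \<Lambda> g'" "\<kappa> = cmp \<Lambda> f' g'"
    by auto
  have cmp_eq: "cmp \<Lambda> f g = cmp \<Lambda> f' g'" using \<kappa> f'(6) by simp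
  have "rng \<Lambda> f' = v"
    using rng_cmp[OF f(1) g(1,3)] rng_cmp[OF f'(1,2,5)] rng_f cmp_eq by simp
  then have "f' \<in> E"
    using pairing[OF E f(2) _ _ _ _ g(3) f'(5) cmp_eq] f g f'(1-4) by (auto simp: edges_iff)
  then have "(f', g') \<in> two_step E j i"
    using f' by (simp add: two_step_iff[OF E])
  then show "\<kappa> \<in> case_prod (cmp \<Lambda>) ` two_step E j i" using f'(6) by force
qed

lemma inj_two_step:
  assumes E: "E = E1 \<or> E = E2"
  shows "inj_on (case_prod (cmp \<Lambda>)) (two_step E i j)"
proof (rule inj_onI, clarify)
  fix f g f' g'
  assume "(f, g) \<in> two_step E i j" "(f', g') \<in> two_step E i j" "cmp \<Lambda> f g = cmp \<Lambda> f' g'"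
  then show "f = f' \<and> g = g'"
    unfolding two_step_iff[OF E] by (intro factorization_unique) auto
qed

text \<open>A double sum is a sum over pairs; composition is injective on these and preserves the
  source of the second factor.\<close>

lemma expand_two_step:
  assumes E: "E = E1 \<or> E = E2"
  shows "mset_extend (\<lambda>(w, n). expand \<Lambda> (mor_from \<Lambda> w (axis j 1)) (n + axis j 1))
      (expand \<Lambda> (block E i) n) =
    expand \<Lambda> (case_prod (cmp \<Lambda>) ` two_step E i j) (n + axis j 1)"
proof -
  have src_fin: "finite (mor_from \<Lambda> (src \<Lambda> f) (axis j 1))" if "f \<in> block E i" for f
    using block_src[OF E that] by (rule finite_mor_from)
  \<comment> \<open>Stated for all subsets \<open>S\<close> of the block, to allow induction on a
    finite set while the sources remain vertices.\<close>
  have "mset_extend (\<lambda>f. expand \<Lambda> (mor_from \<Lambda> (src \<Lambda> f) (axis j 1)) m) (mset_set S) =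
      {#(src \<Lambda> (snd p), m). p \<in># mset_set (SIGMA f:S. mor_from \<Lambda> (src \<Lambda> f) (axis j 1))#}"
    if "S \<subseteq> block E i" for S m
    using finite_subset[OF that block_props(1)[OF E]] that
  proof (induction S rule: finite_induct)
    case (insert f S)
    let ?A = "\<lambda>f. mor_from \<Lambda> (src \<Lambda> f) (axis j 1)"
    have "Sigma (insert f S) ?A = Pair f ` ?A f \<union> Sigma S ?A" by auto
    then have "mset_set (Sigma (insert f S) ?A) = mset_set (Pair f ` ?A f) + mset_set (Sigma S ?A)"
      using insert src_fin by (auto intro!: mset_set_Union finite_SigmaI)
    moreover have "mset_set (Pair f ` ?A f) = image_mset (Pair f) (mset_set (?A f))"
      by (rule image_mset_mset_set[symmetric]) (auto simp: inj_on_def)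
    ultimately show ?case
      using insert by (simp add: expand_def multiset.map_comp comp_def)
  qed simp
  from this[OF subset_refl]
  have "mset_extend (\<lambda>(w, n). expand \<Lambda> (mor_from \<Lambda> w (axis j 1)) (n + axis j 1))
      (expand \<Lambda> (block E i) n) =
      {#(src \<Lambda> (snd p), n + axis j 1). p \<in># mset_set (two_step E i j)#}"
    by (simp add: expand_def[of \<Lambda> "block E i"] mset_extend_image comp_def two_step_def)
  also have "\<dots> = {#(src \<Lambda> (case_prod (cmp \<Lambda>) p), n + axis j 1). p \<in># mset_set (two_step E i j)#}"
  proof (rule image_mset_cong)
    fix p assume "p \<in># mset_set (two_step E i j)"
    then have "p \<in> two_step E i j" by (cases "finite (two_step E i j)") auto
    then show "(src \<Lambda> (snd p), n + axis j 1) = (src \<Lambda> (case_prod (cmp \<Lambda>) p), n + axis j 1)"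
      by (cases p) (simp add: two_step_iff[OF E] src_cmp)
  qed
  also have "\<dots> = expand \<Lambda> (case_prod (cmp \<Lambda>) ` two_step E i j) (n + axis j 1)"
    by (simp add: expand_def image_mset_mset_set[OF inj_two_step[OF E], symmetric]
        multiset.map_comp comp_def)
  finally show ?thesis .
qed

lemma tal_cong_two_step:
  assumes E: "E = E1 \<or> E = E2"
  shows "tal_cong \<Lambda> (expand \<Lambda> (block E i) n)
    (expand \<Lambda> (case_prod (cmp \<Lambda>) ` two_step E i j) (n + axis j 1))"
proof -
  \<comment> \<open>Writing the sum as an extension of singletons lets the relation of colour
    \<open>j\<close> act on each term.\<close>
  have "tal_cong \<Lambda> (mset_extend (\<lambda>x. {#x#}) (expand \<Lambda> (block E i) n))
    (mset_extend (\<lambda>(w, n). expand \<Lambda> (mor_from \<Lambda> w (axis j 1)) (n + axis j 1))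
      (expand \<Lambda> (block E i) n))"
    using block_src[OF E] block_props(1)[OF E]
    by (intro tal_cong_extend) (auto simp: expand_def[of \<Lambda> "block E i"] intro!: tal_cong_rel)
  then show ?thesis by (simp add: mset_extend_id expand_two_step[OF E])
qed

text \<open>Expanding each side in the other's colour gives sums over the same set of
  composites.\<close>

lemma tal_cong_block:
  assumes E: "E = E1 \<or> E = E2"
  shows "tal_cong \<Lambda> (expand \<Lambda> (block E i) (n + axis i 1)) (expand \<Lambda> (block E j) (n + axis j 1))"
proof -
  have "case_prod (cmp \<Lambda>) ` two_step E i j = case_prod (cmp \<Lambda>) ` two_step E j i"
    using two_step_comp_subset[OF E] by blast
  moreover have "n + axis i 1 + axis j 1 = n + axis j 1 + axis i 1" by (simp add: add_ac)
  ultimately show ?thesis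
    using tal_cong_two_step[OF E, of i "n + axis i 1" j] tal_cong_two_step[OF E, of j "n + axis j 1" i]
    by (metis tal_cong.sym tal_cong.trans)
qed

section \<open>The inverse on free monoids\<close>

definition colour :: 'k where "colour = (SOME i. True)"

text \<open>No single symbol of \<open>\<Lambda>\<close> is assigned to a copy of \<open>v\<close>;
  its block of the fixed colour stands in for it. Among vertices of the in-split, \<open>w\<close>
  in the copy cases is always \<open>v\<close>.\<close>

fun merge_gen :: "'v split \<times> (int ^ 'k) \<Rightarrow> ('v \<times> (int ^ 'k)) multiset" where
  "merge_gen (Orig w, n) = {#(w, n)#}"
| "merge_gen (Copy1 w, n) = expand \<Lambda> (block E1 colour) (n + axis colour 1)"
| "merge_gen (Copy2 w, n) = expand \<Lambda> (block E2 colour) (n + axis colour 1)"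

abbreviation "merge_mset \<equiv> mset_extend merge_gen"

lemma expand_block_free: "E = E1 \<or> E = E2 \<Longrightarrow> expand \<Lambda> (block E i) n \<in> tal_free \<Lambda>"
  \<comment> \<open>Freeness is read off from a congruence having this sum as its left side.\<close>
  using T.tal_cong_free tal_cong_two_step by blast

lemma merge_gen_free: "u \<in> Vert \<Lambda>\<^sub>I \<Longrightarrow> merge_gen (u, n) \<in> tal_free \<Lambda>"
  by (auto simp: Vert_insplit I_verts_def expand_block_free)

lemma merge_mset_free: "M \<in> tal_free \<Lambda>\<^sub>I \<Longrightarrow> merge_mset M \<in> tal_free \<Lambda>"
  by (rule mset_extend_tal_free) (metis prod.collapse merge_gen_free tal_freeD)

text \<open>The two blocks of \<open>colour\<close> add up to the full expansion of
  \<open>v\<close>, so this is a defining relation reversed.\<close>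

lemma merge_split_gen:
  assumes "w \<in> Vert \<Lambda>"
  shows "tal_cong \<Lambda> (merge_mset (split_gen (w, n))) {#(w, n)#}"
proof (cases "w = v")
  case True
  have "tal_cong \<Lambda> {#(v, n)#} (merge_mset (split_gen (v, n)))"
    using tal_cong_rel[OF v_Vert, of n colour] by (simp add: expand_mor_from_v)
  then show ?thesis using True by (blast intro: tal_cong.sym)
qed (use assms in \<open>auto intro: tal_cong.refl\<close>)

lemma merge_split:
  assumes "M \<in> tal_free \<Lambda>"
  shows "tal_cong \<Lambda> (merge_mset (split_mset M)) M"
proof -
  have "tal_cong \<Lambda> (merge_mset (split_gen x)) {#x#}" if "x \<in># M" for x
    using merge_split_gen[of "fst x" "snd x"] tal_freeD[OF assms that] by simp
  then have "tal_cong \<Lambda> (merge_mset (split_mset M)) (mset_extend (\<lambda>x. {#x#}) M)"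
    unfolding mset_extend_compose by (intro tal_cong_extend) simp
  then show ?thesis by (simp add: mset_extend_id)
qed

text \<open>At a copy of \<open>v\<close>, \<open>tal_cong_block\<close> passes from
  \<open>colour\<close> to \<open>i\<close>, and \<open>merge_split\<close> absorbs the detour
  through the in-split. At other vertices the relation of \<open>\<Lambda>\<close> takes the place
  of the colour change.\<close>

lemma tal_cong_merge_gen:
  assumes "u \<in> Vert \<Lambda>\<^sub>I"
  shows "tal_cong \<Lambda> (merge_gen (u, n))
    (merge_mset (expand \<Lambda>\<^sub>I (mor_from \<Lambda>\<^sub>I u (axis i 1)) (n + axis i 1)))"
proof -
  have copy: "tal_cong \<Lambda> (expand \<Lambda> (block E colour) (n + axis colour 1))
      (merge_mset (split_mset (expand \<Lambda> (block E i) (n + axis i 1))))" if "E = E1 \<or> E = E2" for E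
    using tal_cong_block[OF that] merge_split[OF expand_block_free[OF that]]
    by (metis tal_cong.sym tal_cong.trans)
  consider (Orig) w where "u = Orig w" "w \<in> Vert \<Lambda>" "w \<noteq> v" | (Copy1) "u = Copy1 v" | (Copy2) "u = Copy2 v"
    using assms by (auto simp: Vert_insplit I_verts_def)
  then show ?thesis
  proof cases
    case Orig
    have rel: "tal_cong \<Lambda> {#(w, n)#} (expand \<Lambda> (mor_from \<Lambda> w (axis i 1)) (n + axis i 1))"
      using tal_cong_rel[OF Orig(2)] .
    with T.tal_cong_free[OF rel] merge_split show ?thesis
      by (simp add: Orig expand_insplit_Orig) (metis tal_cong.sym tal_cong.trans)
  qed (use copy in \<open>simp_all add: expand_insplit_Copy1 expand_insplit_Copy2\<close>)
qed

lemma tal_cong_merge_mset: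
  "tal_cong \<Lambda>\<^sub>I M N \<Longrightarrow> tal_cong \<Lambda> (merge_mset M) (merge_mset N)"
  by (erule tal_cong_mset_extend) (rule merge_gen_free tal_cong_merge_gen, assumption)+

text \<open>The split of a block sum is the right-hand side of the relation at that copy of
  \<open>v\<close>.\<close>

lemma split_merge_gen:
  assumes "u \<in> Vert \<Lambda>\<^sub>I"
  shows "tal_cong \<Lambda>\<^sub>I (split_mset (merge_gen (u, n))) {#(u, n)#}"
proof -
  consider (Orig) w where "u = Orig w" "w \<noteq> v" | (Copy1) "u = Copy1 v" | (Copy2) "u = Copy2 v"
    using assms by (auto simp: Vert_insplit I_verts_def)
  then show ?thesis
  proof cases
    case Orig
    then show ?thesis using assms by (auto intro: tal_cong.refl)
  qed (use tal_cong_rel[OF assms, of n colour] in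
      \<open>auto simp: expand_insplit_Copy1 expand_insplit_Copy2 intro: tal_cong.sym\<close>)
qed

lemma split_merge:
  assumes "M \<in> tal_free \<Lambda>\<^sub>I"
  shows "tal_cong \<Lambda>\<^sub>I (split_mset (merge_mset M)) M"
proof -
  have "tal_cong \<Lambda>\<^sub>I (split_mset (merge_gen x)) {#x#}" if "x \<in># M" for x
    using split_merge_gen[of "fst x" "snd x"] tal_freeD[OF assms that] by simp
  then have "tal_cong \<Lambda>\<^sub>I (split_mset (merge_mset M)) (mset_extend (\<lambda>x. {#x#}) M)"
    unfolding mset_extend_compose by (intro tal_cong_extend) simp
  then show ?thesis by (simp add: mset_extend_id)
qed

section \<open>Passage to the talented monoids\<close>

lemma split_generator:
  assumes "w \<in> Vert \<Lambda>"
  shows "tal_class \<Lambda>\<^sub>I (split_gen (w, n)) =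
    (if w \<noteq> v then tal_gen \<Lambda>\<^sub>I (Orig w) n
     else tal_gen \<Lambda>\<^sub>I (Copy1 v) n \<otimes>\<^bsub>talented_monoid \<Lambda>\<^sub>I\<^esub> tal_gen \<Lambda>\<^sub>I (Copy2 v) n)"
  unfolding tal_gen_def
  by (simp add: TI.mult_tal_class Vert_insplit I_verts_def add_mset_commute)

lemma insplit_map_exists: "\<exists>\<phi>. is_insplit_map \<Lambda> v E1 \<phi>"
proof -
  define \<phi> where "\<phi> X = (\<Union>M\<in>X. tal_class \<Lambda>\<^sub>I (split_mset M))" for X
  have \<phi>_class: "\<phi> (tal_class \<Lambda> M) = tal_class \<Lambda>\<^sub>I (split_mset M)" if "M \<in> tal_free \<Lambda>" for M
    unfolding \<phi>_def using that
    by (intro T.UN_tal_class)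
      (metis TI.tal_class_eq_iff split_mset_free tal_cong_split_mset)+
  have "\<phi> \<in> monoid_homs (talented_monoid \<Lambda>) (talented_monoid \<Lambda>\<^sub>I)"
    unfolding monoid_homs_def hom_def
    by (auto simp: carrier_talented one_talented \<phi>_class split_mset_free
        T.mult_tal_class TI.mult_tal_class)
  moreover have "\<phi> (tal_gen \<Lambda> w n) = tal_class \<Lambda>\<^sub>I (split_gen (w, n))" if "w \<in> Vert \<Lambda>" for w n
    using that \<phi>_class[of "{#(w, n)#}"] by (simp add: tal_gen_def)
  ultimately show ?thesis
    unfolding is_insplit_map_def using split_generator by metis
qed

text \<open>Generators determine a homomorphism, so every admissible \<phi> is computed by
  \<open>split_mset\<close> on representatives.\<close>

lemma insplit_map_eq:
  assumes "is_insplit_map \<Lambda> v E1 \<phi>" "M \<in> tal_free \<Lambda>"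
  shows "\<phi> (tal_class \<Lambda> M) = tal_class \<Lambda>\<^sub>I (split_mset M)"
  using assms(2)
proof (induction M)
  case empty
  then show ?case
    using assms(1) by (simp add: is_insplit_map_def monoid_homs_def one_talented)
next
  case (add x M)
  obtain w n where x: "x = (w, n)" by (cases x)
  have w: "w \<in> Vert \<Lambda>" and M: "M \<in> tal_free \<Lambda>" using add.prems x by auto
  have "tal_class \<Lambda> (add_mset x M) = tal_gen \<Lambda> w n \<otimes>\<^bsub>talented_monoid \<Lambda>\<^esub> tal_class \<Lambda> M"
    unfolding tal_gen_def using w M by (simp add: T.mult_tal_class x)
  moreover have "tal_gen \<Lambda> w n \<in> carrier (talented_monoid \<Lambda>)"
    "tal_class \<Lambda> M \<in> carrier (talented_monoid \<Lambda>)"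
    using w M by (auto simp: carrier_talented tal_gen_def)
  ultimately have "\<phi> (tal_class \<Lambda> (add_mset x M)) =
      \<phi> (tal_gen \<Lambda> w n) \<otimes>\<^bsub>talented_monoid \<Lambda>\<^sub>I\<^esub> \<phi> (tal_class \<Lambda> M)"
    using assms(1) by (simp add: is_insplit_map_def monoid_homs_def hom_mult)
  also have "\<phi> (tal_gen \<Lambda> w n) = tal_class \<Lambda>\<^sub>I (split_gen (w, n))"
    using assms(1) w split_generator by (simp add: is_insplit_map_def)
  also have "\<phi> (tal_class \<Lambda> M) = tal_class \<Lambda>\<^sub>I (split_mset M)" by (rule add.IH[OF M])
  also have "tal_class \<Lambda>\<^sub>I (split_gen (w, n)) \<otimes>\<^bsub>talented_monoid \<Lambda>\<^sub>I\<^esub> tal_class \<Lambda>\<^sub>I (split_mset M) =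
      tal_class \<Lambda>\<^sub>I (split_mset (add_mset x M))"
    by (simp add: TI.mult_tal_class[OF split_gen_free[OF w] split_mset_free[OF M]] x del: split_gen.simps)
  finally show ?case .
qed

lemma insplit_map_iso:
  assumes \<phi>: "is_insplit_map \<Lambda> v E1 \<phi>"
  shows "\<phi> \<in> tal_equivariant_isos \<Lambda> \<Lambda>\<^sub>I"
proof -
  have "inj_on \<phi> (carrier (talented_monoid \<Lambda>))"
  proof (rule inj_onI, unfold carrier_talented, elim imageE)
    fix X Y M N
    assume X: "X = tal_class \<Lambda> M" "M \<in> tal_free \<Lambda>" and Y: "Y = tal_class \<Lambda> N" "N \<in> tal_free \<Lambda>"
      and "\<phi> X = \<phi> Y"
    then have "tal_cong \<Lambda>\<^sub>I (split_mset M) (split_mset N)"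
      by (simp add: insplit_map_eq[OF \<phi>] TI.tal_class_eq_iff split_mset_free)
    \<comment> \<open>Merging undoes splitting up to congruence, which gives injectivity.\<close>
    from tal_cong_merge_mset[OF this] have "tal_cong \<Lambda> M N"
      using merge_split X Y by (metis tal_cong.sym tal_cong.trans)
    then show "X = Y" using X Y by (simp add: T.tal_class_eq_iff)
  qed
  moreover have "\<phi> ` carrier (talented_monoid \<Lambda>) = carrier (talented_monoid \<Lambda>\<^sub>I)"
  proof -
    have "tal_class \<Lambda>\<^sub>I N \<in> \<phi> ` tal_class \<Lambda> ` tal_free \<Lambda>" if "N \<in> tal_free \<Lambda>\<^sub>I" for N
    proof -
      \<comment> \<open>The merged multiset serves as a preimage.\<close>
      have "\<phi> (tal_class \<Lambda> (merge_mset N)) = tal_class \<Lambda>\<^sub>I (split_mset (merge_mset N))"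
        by (rule insplit_map_eq[OF \<phi> merge_mset_free[OF that]])
      also have "\<dots> = tal_class \<Lambda>\<^sub>I N"
        using split_merge[OF that] TI.tal_class_eq_iff TI.tal_cong_free by blast
      finally show ?thesis using merge_mset_free[OF that] by (metis imageI)
    qed
    then show ?thesis
      by (auto simp: carrier_talented insplit_map_eq[OF \<phi>] split_mset_free)
  qed
  moreover have "\<phi> (tal_act \<Lambda> m X) = tal_act \<Lambda>\<^sub>I m (\<phi> X)"
    if X: "X \<in> carrier (talented_monoid \<Lambda>)" for m X
  proof -
    obtain M where M: "X = tal_class \<Lambda> M" "M \<in> tal_free \<Lambda>"
      using X unfolding carrier_talented by blast
    \<comment> \<open>Equivariance holds already on representatives, since \<open>split_gen\<close>
      leaves degrees unchanged.\<close>
    have "split_mset (shift m M) = shift m (split_mset M)"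
      by (rule shift_mset_extend[symmetric]) simp
    then show ?thesis
      using M by (simp add: T.tal_act_tal_class TI.tal_act_tal_class insplit_map_eq[OF \<phi>] split_mset_free)
  qed
  ultimately show ?thesis
    using \<phi> by (auto simp: tal_equivariant_isos_def is_insplit_map_def bij_betw_def)
qed

end

text \<open>The existence conjunct keeps the universal one from being vacuous.\<close>

theorem theorem3p2:
  fixes \<Lambda> :: "('v, 'm, 'k::finite) kgraph"
    and v :: 'v
    and E1 E2 :: "'m set"
  assumes "k_graph \<Lambda>"
    and "row_finite_no_sources \<Lambda>"
    and "v \<in> Vert \<Lambda>"
    and "insplit_partition \<Lambda> v E1 E2"
  shows "(\<exists>\<phi>. is_insplit_map \<Lambda> v E1 \<phi>) \<and>
    (\<forall>\<phi>. is_insplit_map \<Lambda> v E1 \<phi> \<longrightarrow> \<phi> \<in> tal_equivariant_isos \<Lambda> (insplit \<Lambda> v E1))"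
proof -
  interpret insplit_data \<Lambda> v E1 E2
    using assms by (simp add: insplit_data_def insplit_data_axioms_def)
  show ?thesis using insplit_map_exists insplit_map_iso by blast
qed

end
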